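(* Let $n\in\mathbb{N}$ and let $I_1,\dots,I_n$ be independent indicator random variables with success probabilities $p_j=\mathbf{P}(I_j=1)\in[0,1)$, $1\le j\le n$. Let $q_j=1-p_j$, $r_j=p_j/q_j$, $R_l=\sum_{j=l}^n r_j$ for $1\le l\le n$, let $s=\max\{1,\max\{l: R_l\ge 1\}\}$ (with $\max\varnothing=-\infty$) be the threshold index, and let $V_n=\left(\prod_{j=s}^n q_j\right)\sum_{l=s}^n r_l$ be the success probability under the optimal stopping rule. Then $$V_n\le \frac{R_s}{1+R_s}.$$ This upper bound is attained only for the sequence of indicator-function probabilities given by $$p_s=\frac{R_s}{1+R_s},\qquad p_j=0\ \text{ for all } j\ne s.$$
   Context: Setting (last-success optimal stopping problem): $I_1,\dots,I_n$ are independent indicator random variables with known success probabilities, observed sequentially. A stopping time is a random variable $t$ with $\{t=k\}\in\sigma(I_1,\dots,I_k)$ for every $1\le k\le n$. One "wins" when stopping at time $t$ if $I_t=1,\ I_{t+1}=0,\dots,I_n=0$, that is, if one stops at the last success. Notation: $p_j=\mathbf{P}(I_j=1)$, $q_j=1-p_j$, odds $r_j=p_j/q_j$, and sums of odds $R_l=\sum_{j=l}^n r_j$ for $1\le l\le n$. The threshold index is $s=\max\{1,\max\{l\in\{1,\dots,n\}: R_l\ge 1\}\}$ with the convention $\max\varnothing=-\infty$ (so $s=1$ if $R_1<1$). The optimal stopping rule $\tau$ (Bruss' odds theorem, known) is to stop at the first index $k\ge s$ with $I_k=1$, if such an index exists. Its winning probability is $$V_n=\mathbf{P}(I_\tau=1,I_{\tau+1}=0,\dots,I_n=0)=\left(\prod_{j=s}^n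 q_j\right)\sum_{l=s}^n r_l .$$
   Formalization: "Attained only for" is false as stated (n=2, p_1=p_2=1/2). Proved: equality iff p_j, s≤j≤n, vanish except at one index k≥s with p_k=R_s/(1+R_s); k=s if R_s≥1 or p_s≠0; p_j for j<s are not forced to be 0. The given sequence attains the bound. *)

theory Defs
  imports "HOL-Probability.Probability"
begin

definition odds :: "(nat \<Rightarrow> real) \<Rightarrow> nat \<Rightarrow> real" where
  "odds p j = p j / (1 - p j)"

definition odds_sum :: "(nat \<Rightarrow> real) \<Rightarrow> nat \<Rightarrow> nat \<Rightarrow> real" where
  "odds_sum p n l = (\<Sum>j = l..n. odds p j)"

text \<open>Inserting \<open>1\<close> renders the convention that the maximum of the empty set is \<open>-\<infinity>\<close>.\<close>

definition threshold :: "(nat \<Rightarrow> real) \<Rightarrow> nat \<Rightarrow> nat" where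
  "threshold p n = Max (insert 1 {l \<in> {1..n}. odds_sum p n l \<ge> 1})"

definition opt_value :: "(nat \<Rightarrow> real) \<Rightarrow> nat \<Rightarrow> real" where
  "opt_value p n =
     (\<Prod>j = threshold p n..n. 1 - p j) * (\<Sum>l = threshold p n..n. odds p l)"

text \<open>Stop at the first success with index at least \<open>s\<close>; the value \<open>Suc n\<close> means
  that the rule never stops.\<close>

definition odds_rule :: "(nat \<Rightarrow> 'a \<Rightarrow> real) \<Rightarrow> nat \<Rightarrow> nat \<Rightarrow> 'a \<Rightarrow> nat" where
  "odds_rule I n s \<omega> =
     (if \<exists>k\<in>{s..n}. I k \<omega> = 1 then LEAST k. k \<in> {s..n} \<and> I k \<omega> = 1 else Suc n)"

definition wins :: "(nat \<Rightarrow> 'a \<Rightarrow> real) \<Rightarrow> nat \<Rightarrow> nat \<Rightarrow> 'a \<Rightarrow> bool" where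
  "wins I n t \<omega> \<longleftrightarrow> t \<in> {1..n} \<and> I t \<omega> = 1 \<and> (\<forall>j\<in>{t<..n}. I j \<omega> = 0)"

end

(* With r_j = p_j / q_j one has q_j = 1 / (1 + r_j), so the odds rule wins with probability
   R / prod_j (1 + r_j), and the bound is the inequality 1 + sum_j r_j <= prod_j (1 + r_j).
   Expanding the product shows that equality forces r_i r_j = 0 for all i ~= j. *)

theory Submission
  imports Defs
begin

section \<open>Comparing a product of factors \<open>1 + r j\<close> with its linear part\<close>

lemma one_plus_sum_le_prod:
  fixes r :: "'b \<Rightarrow> real"
  assumes "\<And>j. j \<in> A \<Longrightarrow> r j \<ge> 0"
  shows "1 + sum r A \<le> (\<Prod>j\<in>A. 1 + r j)"
  using assms
proof (induction A rule: infinite_finite_induct)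
  case (insert x A)
  \<comment> \<open>The two sides differ by the cross term \<open>r x * sum r A\<close>, which is
    nonnegative.\<close>
  have "1 + sum r (insert x A) \<le> (1 + r x) * (1 + sum r A)"
    using insert by (simp add: algebra_simps sum_nonneg)
  also have "\<dots> \<le> (1 + r x) * (\<Prod>j\<in>A. 1 + r j)"
    using insert by (intro mult_left_mono) auto
  finally show ?case using insert by simp
qed auto

text \<open>Splitting off the factor at \<open>k\<close> and bounding the rest from below leaves the
  surplus \<open>r k * sum r (A - {k})\<close> over the linear part. Equality forces this surplus to
  vanish, and it dominates \<open>r k * r j\<close>.\<close>

lemma one_plus_sum_eq_prod_imp:
  fixes r :: "'b \<Rightarrow> real"
  assumes fin: "finite A" and nonneg: "\<And>j. j \<in> A \<Longrightarrow> r j \<ge> 0"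
    and eq: "(\<Prod>j\<in>A. 1 + r j) = 1 + sum r A"
    and k: "k \<in> A" and j: "j \<in> A" "j \<noteq> k"
  shows "r k * r j = 0"
proof -
  have rk: "0 \<le> r k" using nonneg k by auto
  have "r j \<le> sum r (A - {k})"
    using fin nonneg j by (intro member_le_sum) auto
  then have "r k * r j \<le> r k * sum r (A - {k})"
    using rk by (intro mult_left_mono)
  moreover have "(1 + r k) * (1 + sum r (A - {k})) \<le> (1 + r k) * (\<Prod>j\<in>A - {k}. 1 + r j)"
    using rk nonneg by (intro mult_left_mono one_plus_sum_le_prod) auto
  then have "(1 + r k) * (1 + sum r (A - {k})) \<le> 1 + r k + sum r (A - {k})"
    using eq fin k by (simp add: prod.remove[of A k] sum.remove[of A k])
  ultimately have "r k * r j \<le> 0"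
    by (simp add: algebra_simps)
  then show ?thesis
    using mult_nonneg_nonneg[OF rk nonneg[OF j(1)]] by linarith
qed

lemma one_plus_sum_eq_prod_iff:
  fixes r :: "'b \<Rightarrow> real"
  assumes "finite A" "A \<noteq> {}" and "\<And>j. j \<in> A \<Longrightarrow> r j \<ge> 0"
  shows "(\<Prod>j\<in>A. 1 + r j) = 1 + sum r A \<longleftrightarrow> (\<exists>k\<in>A. \<forall>j\<in>A - {k}. r j = 0)"
proof
  assume eq: "(\<Prod>j\<in>A. 1 + r j) = 1 + sum r A"
  show "\<exists>k\<in>A. \<forall>j\<in>A - {k}. r j = 0"
  \<comment> \<open>An index with nonzero value is the witness, since the vanishing products
    annihilate all other values. If every value is zero, any element of the nonempty
    \<open>A\<close> serves.\<close>
  proof (cases "\<exists>k\<in>A. r k \<noteq> 0")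
    case True
    then show ?thesis
      using one_plus_sum_eq_prod_imp[OF assms(1,3) eq] by (metis DiffE insertI1 mult_eq_0_iff)
  next
    case False
    then show ?thesis using assms(2) by auto
  qed
next
  assume "\<exists>k\<in>A. \<forall>j\<in>A - {k}. r j = 0"
  then obtain k where "k \<in> A" "\<forall>j\<in>A - {k}. r j = 0" by blast
  then show "(\<Prod>j\<in>A. 1 + r j) = 1 + sum r A"
    using assms(1) by (simp add: prod.remove[of A k] sum.remove[of A k])
qed

section \<open>Odds and the threshold index\<close>

lemma odds_nonneg: "p j \<in> {0..<1} \<Longrightarrow> odds p j \<ge> 0"
  by (simp add: odds_def)

lemma odds_eq_0_iff: "p j \<noteq> 1 \<Longrightarrow> odds p j = 0 \<longleftrightarrow> p j = 0"
  by (simp add: odds_def)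

lemma one_minus_eq_inverse_odds: "p j \<noteq> 1 \<Longrightarrow> 1 - p j = inverse (1 + odds p j)"
  by (simp add: odds_def field_simps)

lemma odds_div_one_plus_odds: "p j \<noteq> 1 \<Longrightarrow> odds p j / (1 + odds p j) = p j"
  by (simp add: odds_def field_simps)

lemma odds_of_div_one_plus:
  assumes "R \<ge> 0" "p j = R / (1 + R)"
  shows "odds p j = R"
proof -
  have "1 - p j = 1 / (1 + R)"
    using assms by (simp add: field_simps)
  then show ?thesis
    using assms by (simp add: odds_def)
qed

lemma odds_sum_remove:
  "k \<in> {l..n} \<Longrightarrow> odds_sum p n l = odds p k + (\<Sum>j\<in>{l..n} - {k}. odds p j)"
  by (simp add: odds_sum_def sum.remove)

lemma opt_value_eq:
  assumes "\<And>j. j \<in> {threshold p n..n} \<Longrightarrow> p j \<noteq> 1"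
  shows "opt_value p n =
    odds_sum p n (threshold p n) / (\<Prod>j = threshold p n..n. 1 + odds p j)"
proof -
  have "(\<Prod>j = threshold p n..n. 1 - p j) = inverse (\<Prod>j = threshold p n..n. 1 + odds p j)"
    unfolding prod_inversef[symmetric] o_def
    using assms by (intro prod.cong refl one_minus_eq_inverse_odds)
  then show ?thesis
    by (simp add: opt_value_def odds_sum_def divide_simps)
qed

lemma threshold_mem: "n \<ge> 1 \<Longrightarrow> threshold p n \<in> {1..n}"
  unfolding threshold_def
  using Max_in[of "insert 1 {l \<in> {1..n}. odds_sum p n l \<ge> 1}"] by auto

lemma le_threshold: "l \<in> {1..n} \<Longrightarrow> odds_sum p n l \<ge> 1 \<Longrightarrow> l \<le> threshold p n"
  unfolding threshold_def by (intro Max_ge) auto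

text \<open>The maximum belongs to its set: it is either the inserted \<open>1\<close> or an index
  whose odds sum reaches one.\<close>

lemma threshold_eq_1: "odds_sum p n (threshold p n) < 1 \<Longrightarrow> threshold p n = 1"
  unfolding threshold_def
  using Max_in[of "insert 1 {l \<in> {1..n}. odds_sum p n l \<ge> 1}"] by auto

section \<open>The upper bound, its equality case and the extremal sequences\<close>

text \<open>The value is \<open>R / P\<close> with \<open>P \<ge> 1 + R\<close>, so equality reduces
  to the equality case of the product inequality. The single success index \<open>k\<close> need not
  be \<open>s\<close>: if \<open>R < 1\<close>, then \<open>s = 1\<close> and the only nonzero
  probability may sit anywhere.\<close>

lemma opt_value_bound:
  assumes n: "n \<ge> 1" and p: "\<And>j. j \<in> {1..n} \<Longrightarrow> p j \<in> {0..<1}"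
    and s: "s = threshold p n" and R: "R = odds_sum p n s"
  shows "opt_value p n \<le> R / (1 + R)"
    and "opt_value p n = R / (1 + R) \<longleftrightarrow>
      (\<exists>k\<in>{s..n}. p k = R / (1 + R) \<and> (\<forall>j\<in>{s..n} - {k}. p j = 0))"
proof -
  define P where "P = (\<Prod>j = s..n. 1 + odds p j)"
  have s_mem: "s \<in> {1..n}"
    using threshold_mem[OF n] s by simp
  then have ps: "p j \<in> {0..<1}" if "j \<in> {s..n}" for j
    using p that by auto
  then have p1: "p j \<noteq> 1" if "j \<in> {s..n}" for j
    using that by force
  have nonneg: "odds p j \<ge> 0" if "j \<in> {s..n}" for j
    by (rule odds_nonneg[of p j, OF ps[OF that]])
  have R0: "R \<ge> 0"
    unfolding R odds_sum_def by (intro sum_nonneg nonneg)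
  have PR: "1 + R \<le> P"
    unfolding P_def R odds_sum_def by (intro one_plus_sum_le_prod nonneg)
  have V: "opt_value p n = R / P"
    using opt_value_eq[of p n] p1 unfolding P_def R s by simp
  show "opt_value p n \<le> R / (1 + R)"
    unfolding V using R0 PR by (intro divide_left_mono mult_pos_pos) auto
  \<comment> \<open>Cancelling \<open>R\<close> needs \<open>R \<noteq> 0\<close>. The degenerate
    case is absorbed next: \<open>R = 0\<close> makes all odds vanish, so that
    \<open>P = 1 = 1 + R\<close>.\<close>
  have "opt_value p n = R / (1 + R) \<longleftrightarrow> R = 0 \<or> P = 1 + R"
    unfolding V using R0 PR by (auto simp: field_simps)
  also have "\<dots> \<longleftrightarrow> P = 1 + R"
  proof -
    have "P = 1 + R" if "R = 0"
    proof -
      have "odds p j = 0" if "j \<in> {s..n}" for j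
        using \<open>R = 0\<close> that sum_nonneg_eq_0_iff[of "{s..n}" "odds p"] nonneg
        unfolding R odds_sum_def by auto
      then show ?thesis using \<open>R = 0\<close> by (simp add: P_def)
    qed
    then show ?thesis by blast
  qed
  also have "\<dots> \<longleftrightarrow> (\<exists>k\<in>{s..n}. \<forall>j\<in>{s..n} - {k}. odds p j = 0)"
    unfolding P_def R odds_sum_def using s_mem nonneg
    by (intro one_plus_sum_eq_prod_iff) auto
  also have "\<dots> \<longleftrightarrow> (\<exists>k\<in>{s..n}. \<forall>j\<in>{s..n} - {k}. p j = 0)"
    using p1 odds_eq_0_iff[of p] by simp
  also have "\<dots> \<longleftrightarrow> (\<exists>k\<in>{s..n}. p k = R / (1 + R) \<and> (\<forall>j\<in>{s..n} - {k}. p j = 0))"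
  proof -
    \<comment> \<open>Once the other odds vanish, \<open>R\<close> is the odds at \<open>k\<close>,
      and inverting the odds map determines \<open>p k\<close>.\<close>
    have "p k = R / (1 + R)" if k: "k \<in> {s..n}" and 0: "\<forall>j\<in>{s..n} - {k}. p j = 0" for k
    proof -
      have "(\<Sum>j\<in>{s..n} - {k}. odds p j) = 0"
        using 0 by (intro sum.neutral) (auto simp: odds_def)
      then have "R = odds p k"
        unfolding R using odds_sum_remove[OF k, of p] by simp
      then show ?thesis
        using odds_div_one_plus_odds[of p k] p1[OF k] by simp
    qed
    then show ?thesis by blast
  qed
  finally show "opt_value p n = R / (1 + R) \<longleftrightarrow>
      (\<exists>k\<in>{s..n}. p k = R / (1 + R) \<and> (\<forall>j\<in>{s..n} - {k}. p j = 0))" .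
qed

text \<open>If \<open>p s\<close> were zero, dropping the index \<open>s\<close> would leave the
  odds sum unchanged and at least one, so the threshold would be at least
  \<open>Suc s\<close>.\<close>

lemma success_at_threshold:
  assumes n: "n \<ge> 1" and p: "\<And>j. j \<in> {1..n} \<Longrightarrow> p j \<in> {0..<1}"
    and s: "s = threshold p n" and R: "odds_sum p n s \<ge> 1"
  shows "p s \<noteq> 0"
proof
  assume "p s = 0"
  have s_mem: "s \<in> {1..n}"
    using threshold_mem[OF n] s by simp
  have "odds_sum p n s = odds_sum p n (Suc s)"
    using s_mem \<open>p s = 0\<close> by (simp add: odds_sum_def sum.atLeast_Suc_atMost odds_def)
  then have "odds_sum p n (Suc s) \<ge> 1" using R by simp
  \<comment> \<open>For \<open>s = n\<close> the remaining sum is empty, hence zero.\<close>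
  moreover from this have "Suc s \<le> n"
    by (cases "Suc s \<le> n") (auto simp: odds_sum_def)
  ultimately have "Suc s \<le> s"
    unfolding s using le_threshold[of "Suc (threshold p n)" n p] by simp
  then show False by simp
qed

text \<open>This shows that the bound is attained with the prescribed \<open>s\<close> and
  \<open>R\<close>. The assumption \<open>R1\<close> is what \<open>threshold_eq_1\<close> supplies
  when \<open>R\<close> is the odds sum at a threshold; without it the threshold of the new sequence
  would drop to \<open>1\<close>.\<close>

lemma single_success_optimal:
  assumes n: "n \<ge> 1" and s: "s \<in> {1..n}" and R0: "R \<ge> 0" and R1: "R < 1 \<Longrightarrow> s = 1"
    and ps: "p s = R / (1 + R)" and p0: "\<And>j. j \<in> {1..n} - {s} \<Longrightarrow> p j = 0"
  shows "threshold p n = s" "odds_sum p n s = R" "opt_value p n = R / (1 + R)"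
proof -
  have odds_s: "odds p s = R"
    by (rule odds_of_div_one_plus[of R p s, OF R0 ps])
  have rest: "(\<Sum>j\<in>{l..n} - {s}. odds p j) = 0" if "l \<ge> 1" for l
    using that by (intro sum.neutral) (auto simp: odds_def p0)
  show Rs: "odds_sum p n s = R"
    using odds_sum_remove[of s s n p] s odds_s rest by simp
  show thr: "threshold p n = s"
  proof (cases "R \<ge> 1")
    case True
    have "threshold p n \<le> s"
    \<comment> \<open>All odds after \<open>s\<close> vanish, so a threshold beyond \<open>s\<close>
      would have odds sum zero and hence equal \<open>1\<close>, although it exceeds
      \<open>s\<close>.\<close>
    proof (rule ccontr)
      assume "\<not> threshold p n \<le> s"
      then have "{threshold p n..n} - {s} = {threshold p n..n}" and gt: "threshold p n > 1"
        using s by auto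
      then have "odds_sum p n (threshold p n) = 0"
        using rest[of "threshold p n"] by (simp add: odds_sum_def)
      then show False
        using threshold_eq_1[of p n] gt by simp
    qed
    then show ?thesis
      using le_threshold[OF s] Rs True by (simp add: antisym)
  next
    case False
    then have s1: "s = 1" using R1 by simp
    \<comment> \<open>Odds sums decrease in their starting index, so all of them stay below one and
      the threshold falls back to \<open>1\<close>.\<close>
    have "odds_sum p n (threshold p n) \<le> R"
    proof -
      have "odds p j \<ge> 0" if "j \<in> {1..n}" for j
        using that odds_s R0 p0[of j] by (cases "j = s") (auto simp: odds_def)
      then have "odds_sum p n (threshold p n) \<le> odds_sum p n 1"
        unfolding odds_sum_def using threshold_mem[OF n, of p] by (intro sum_mono2) auto
      then show ?thesis using Rs s1 by simp
    qed
    then show ?thesis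
      using False threshold_eq_1[of p n] s1 by simp
  qed
  have "p j \<in> {0..<1}" if "j \<in> {1..n}" for j
    using that R0 ps p0 by (cases "j = s") auto
  from opt_value_bound(2)[OF n this thr[symmetric] Rs[symmetric]]
  show "opt_value p n = R / (1 + R)"
    using s ps p0 by (auto intro!: bexI[of _ s])
qed

section \<open>The winning event and its probability\<close>

text \<open>The first success from \<open>s\<close> on is also the last one exactly when there is a
  single success in \<open>{s..n}\<close>. This turns the stopping problem into a statement about
  independent indicators.\<close>

lemma wins_odds_rule_iff:
  assumes s: "s \<ge> 1" and I: "\<And>j. j \<in> {1..n} \<Longrightarrow> I j \<omega> \<in> {0, 1}"
  shows "wins I n (odds_rule I n s \<omega>) \<omega> \<longleftrightarrow>
    (\<exists>k\<in>{s..n}. \<forall>j\<in>{s..n}. I j \<omega> = (if j = k then 1 else 0))"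
proof
  assume w: "wins I n (odds_rule I n s \<omega>) \<omega>"
  define t where "t = odds_rule I n s \<omega>"
  \<comment> \<open>The value for never stopping lies outside \<open>{1..n}\<close>, so it cannot
    win.\<close>
  have "t \<noteq> Suc n"
    using w by (simp add: wins_def t_def)
  then have bex: "\<exists>k\<in>{s..n}. I k \<omega> = 1"
    unfolding t_def odds_rule_def by argo
  then have ex: "\<exists>k. k \<in> {s..n} \<and> I k \<omega> = 1"
    by blast
  have t: "t = (LEAST k. k \<in> {s..n} \<and> I k \<omega> = 1)"
    unfolding t_def odds_rule_def by (rule if_P[OF bex])
  have t1: "t \<in> {s..n} \<and> I t \<omega> = 1"
    unfolding t by (rule LeastI_ex[OF ex])
  have "I j \<omega> = (if j = t then 1 else 0)" if j: "j \<in> {s..n}" for j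
  \<comment> \<open>Before \<open>t\<close> minimality excludes the value 1, which leaves 0; after
    \<open>t\<close> the winning condition gives 0.\<close>
  proof (cases j t rule: linorder_cases)
    case less
    then have "I j \<omega> \<noteq> 1" using not_less_Least j unfolding t by blast
    then show ?thesis using less I[of j] j s by auto
  next
    case greater
    then show ?thesis using w j by (auto simp: wins_def t_def)
  qed (use t1 in simp)
  with t1 show "\<exists>k\<in>{s..n}. \<forall>j\<in>{s..n}. I j \<omega> = (if j = k then 1 else 0)" by blast
next
  assume "\<exists>k\<in>{s..n}. \<forall>j\<in>{s..n}. I j \<omega> = (if j = k then 1 else 0)"
  then obtain k where k: "k \<in> {s..n}"
    and Ik: "\<And>j. j \<in> {s..n} \<Longrightarrow> I j \<omega> = (if j = k then 1 else 0)" by blast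
  have "(LEAST k. k \<in> {s..n} \<and> I k \<omega> = 1) = k"
  proof (rule Least_equality)
    show "k \<le> j" if "j \<in> {s..n} \<and> I j \<omega> = 1" for j
      using that Ik[of j] by (cases "j = k") auto
  qed (use k Ik in simp)
  moreover have "\<exists>k\<in>{s..n}. I k \<omega> = 1"
    using k Ik by (intro bexI[of _ k]) simp
  ultimately have "odds_rule I n s \<omega> = k"
    by (simp only: odds_rule_def if_True)
  then show "wins I n (odds_rule I n s \<omega>) \<omega>"
    using k Ik s by (auto simp: wins_def)
qed

lemma (in prob_space) prob_single_success:
  fixes I :: "'b \<Rightarrow> 'a \<Rightarrow> real"
  assumes indep: "indep_vars (\<lambda>_. borel) I A" and B: "finite B" "B \<subseteq> A" "k \<in> B"
    and I: "\<And>j \<omega>. j \<in> B \<Longrightarrow> \<omega> \<in> space M \<Longrightarrow> I j \<omega> \<in> {0, 1}"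
    and p: "\<And>j. j \<in> B \<Longrightarrow> p j = prob {\<omega> \<in> space M. I j \<omega> = 1}"
  shows "prob {\<omega> \<in> space M. \<forall>j\<in>B. I j \<omega> = (if j = k then 1 else 0)} =
    p k * (\<Prod>j\<in>B - {k}. 1 - p j)"
proof -
  \<comment> \<open>The prescribed outcome vector: success at \<open>k\<close>, failure elsewhere.
    Independence then factorizes its probability.\<close>
  define c :: "'b \<Rightarrow> real" where "c j = (if j = k then 1 else 0)" for j
  have rv: "random_variable borel (I j)" if "j \<in> B" for j
    using indep that B unfolding indep_vars_def by auto
  have fail: "prob (I j -` {0} \<inter> space M) = 1 - p j" if j: "j \<in> B" for j
  proof -
    have "{\<omega> \<in> space M. I j \<omega> = 1} \<in> events"
      using rv[OF j] by measurable
    moreover have "I j -` {0} \<inter> space M = space M - {\<omega> \<in> space M. I j \<omega> = 1}"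
      using I[OF j] by fastforce
    ultimately show ?thesis
      using p[OF j] prob_compl by simp
  qed
  \<comment> \<open>Since \<open>k\<close> lies in \<open>B\<close>, the intersection is over a
    nonempty index set and stays inside \<open>space M\<close>.\<close>
  have "{\<omega> \<in> space M. \<forall>j\<in>B. I j \<omega> = c j} = (\<Inter>j\<in>B. I j -` {c j} \<inter> space M)"
    using B(3) by auto
  then have "prob {\<omega> \<in> space M. \<forall>j\<in>B. I j \<omega> = c j} =
      (\<Prod>j\<in>B. prob (I j -` {c j} \<inter> space M))"
    using indep_varsD[OF indep, of B "\<lambda>j. {c j}"] B by auto
  also have "\<dots> = prob (I k -` {c k} \<inter> space M) *
      (\<Prod>j\<in>B - {k}. prob (I j -` {c j} \<inter> space M))"
    using B by (intro prod.remove) auto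
  also have "prob (I k -` {c k} \<inter> space M) = p k"
    using p[OF B(3)] by (simp add: c_def vimage_def Int_def conj_commute)
  also have "(\<Prod>j\<in>B - {k}. prob (I j -` {c j} \<inter> space M)) = (\<Prod>j\<in>B - {k}. 1 - p j)"
    using fail by (intro prod.cong) (auto simp: c_def)
  finally show ?thesis
    by (simp add: c_def)
qed

text \<open>The position of the unique success splits the event into disjoint pieces, each covered
  by \<open>prob_single_success\<close>.\<close>

lemma (in prob_space) prob_unique_success:
  fixes I :: "'b \<Rightarrow> 'a \<Rightarrow> real"
  assumes indep: "indep_vars (\<lambda>_. borel) I A" and B: "finite B" "B \<subseteq> A"
    and I: "\<And>j \<omega>. j \<in> B \<Longrightarrow> \<omega> \<in> space M \<Longrightarrow> I j \<omega> \<in> {0, 1}"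
    and p: "\<And>j. j \<in> B \<Longrightarrow> p j = prob {\<omega> \<in> space M. I j \<omega> = 1}"
  shows "prob {\<omega> \<in> space M. \<exists>k\<in>B. \<forall>j\<in>B. I j \<omega> = (if j = k then 1 else 0)} =
    (\<Sum>k\<in>B. p k * (\<Prod>j\<in>B - {k}. 1 - p j))"
proof -
  define E where "E k = {\<omega> \<in> space M. \<forall>j\<in>B. I j \<omega> = (if j = k then 1 else 0)}" for k
  have rv: "random_variable borel (I j)" if "j \<in> B" for j
    using indep that B unfolding indep_vars_def by auto
  have "E k \<in> events" for k
  proof -
    have "{\<omega> \<in> space M. I j \<omega> = (if j = k then 1 else 0)} \<in> events" if "j \<in> B" for j
      using rv[OF that] by measurable
    then show ?thesis
      unfolding E_def using B(1) by (rule sets.sets_Collect_finite_All)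
  qed
  moreover have "disjoint_family_on E B"
    by (auto simp: disjoint_family_on_def E_def)
  ultimately have "prob (\<Union>k\<in>B. E k) = (\<Sum>k\<in>B. prob (E k))"
    using B(1) by (intro finite_measure_finite_Union) auto
  also have "\<dots> = (\<Sum>k\<in>B. p k * (\<Prod>j\<in>B - {k}. 1 - p j))"
    unfolding E_def using B I p by (intro sum.cong refl prob_single_success[OF indep]) auto
  also have "(\<Union>k\<in>B. E k) =
      {\<omega> \<in> space M. \<exists>k\<in>B. \<forall>j\<in>B. I j \<omega> = (if j = k then 1 else 0)}"
    by (auto simp: E_def)
  finally show ?thesis .
qed

text \<open>Multiplying by the odds at \<open>k\<close> replaces the factor \<open>1 - p k\<close>
  by \<open>p k\<close>. This identifies the closed formula for the value with the probability of a
  unique success.\<close>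

lemma prod_mult_sum_odds:
  assumes "finite B" and "\<And>j. j \<in> B \<Longrightarrow> p j \<noteq> 1"
  shows "(\<Prod>j\<in>B. 1 - p j) * (\<Sum>k\<in>B. odds p k) = (\<Sum>k\<in>B. p k * (\<Prod>j\<in>B - {k}. 1 - p j))"
  unfolding sum_distrib_left
proof (rule sum.cong)
  fix k assume k: "k \<in> B"
  then have "(\<Prod>j\<in>B. 1 - p j) = (1 - p k) * (\<Prod>j\<in>B - {k}. 1 - p j)"
    using assms(1) by (rule prod.remove[rotated])
  then show "(\<Prod>j\<in>B. 1 - p j) * odds p k = p k * (\<Prod>j\<in>B - {k}. 1 - p j)"
    using assms(2)[OF k] by (simp add: odds_def)
qed simp

text \<open>Uniqueness at \<open>s\<close> is stated under
  \<open>R \<ge> 1 \<or> p s \<noteq> 0\<close>: for \<open>n = 2\<close> with probabilities 0 and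
  1/3 one has \<open>s = 1\<close> and \<open>R = 1/2\<close>, and the bound 1/3 is attained with
  the success at index 2. It concerns \<open>{s..n}\<close> only: probabilities 1/4 and 1/2 give
  \<open>s = 2\<close> and attain the bound 1/2 although the first one is nonzero.\<close>

theorem theorem2:
  fixes M :: "'a measure" and I :: "nat \<Rightarrow> 'a \<Rightarrow> real"
    and p :: "nat \<Rightarrow> real" and n s :: nat and R :: real
  assumes "prob_space M"
    and "n \<ge> 1"
    and "prob_space.indep_vars M (\<lambda>_. borel) I {1..n}"
    and "\<And>j \<omega>. j \<in> {1..n} \<Longrightarrow> \<omega> \<in> space M \<Longrightarrow> I j \<omega> \<in> {0, 1}"
    and "\<And>j. j \<in> {1..n} \<Longrightarrow> p j = measure M {\<omega> \<in> space M. I j \<omega> = 1}"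
    and "\<And>j. j \<in> {1..n} \<Longrightarrow> p j \<in> {0..<1}"
    and "s = threshold p n"
    and "R = odds_sum p n s"
  shows "measure M {\<omega> \<in> space M. wins I n (odds_rule I n s \<omega>) \<omega>} = opt_value p n
    \<and> opt_value p n \<le> R / (1 + R)
    \<and> (\<forall>p'. p' s = R / (1 + R) \<and> (\<forall>j\<in>{1..n} - {s}. p' j = 0) \<longrightarrow>
          threshold p' n = s \<and> odds_sum p' n s = R \<and> opt_value p' n = R / (1 + R))
    \<and> (R \<ge> 1 \<or> p s \<noteq> 0 \<longrightarrow>
          (opt_value p n = R / (1 + R) \<longleftrightarrow>
             p s = R / (1 + R) \<and> (\<forall>j\<in>{s..n} - {s}. p j = 0)))
    \<and> (opt_value p n = R / (1 + R) \<longleftrightarrow>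
          (\<exists>k\<in>{s..n}. p k = R / (1 + R) \<and> (\<forall>j\<in>{s..n} - {k}. p j = 0)))"
proof -
  interpret prob_space M by fact
  note n = \<open>n \<ge> 1\<close>
  note p = assms(6) and s = assms(7) and R = assms(8)
  have s_mem: "s \<in> {1..n}"
    using threshold_mem[OF n] s by simp
  then have sub: "{s..n} \<subseteq> {1..n}" by auto
  have p1: "p j \<noteq> 1" if "j \<in> {s..n}" for j
    using p[of j] sub that by auto
  have R0: "R \<ge> 0"
    unfolding R odds_sum_def using p sub by (intro sum_nonneg odds_nonneg) auto
  have "prob {\<omega> \<in> space M. wins I n (odds_rule I n s \<omega>) \<omega>} =
      prob {\<omega> \<in> space M. \<exists>k\<in>{s..n}. \<forall>j\<in>{s..n}. I j \<omega> = (if j = k then 1 else 0)}"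
    using s_mem assms(4) by (intro arg_cong[where f = prob] Collect_cong conj_cong refl
      wins_odds_rule_iff) auto
  also have "\<dots> = (\<Sum>k = s..n. p k * (\<Prod>j\<in>{s..n} - {k}. 1 - p j))"
    using sub assms(4,5) by (intro prob_unique_success[OF assms(3)]) auto
  also have "\<dots> = opt_value p n"
    unfolding opt_value_def s[symmetric] using p1 by (intro prod_mult_sum_odds[symmetric]) auto
  finally have win: "prob {\<omega> \<in> space M. wins I n (odds_rule I n s \<omega>) \<omega>} = opt_value p n" .
  have "R < 1 \<Longrightarrow> s = 1"
    using threshold_eq_1[of p n] R s by simp
  then have single: "\<forall>p'. p' s = R / (1 + R) \<and> (\<forall>j\<in>{1..n} - {s}. p' j = 0) \<longrightarrow>
      threshold p' n = s \<and> odds_sum p' n s = R \<and> opt_value p' n = R / (1 + R)"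
    using single_success_optimal[OF n s_mem R0] by blast
  have le: "opt_value p n \<le> R / (1 + R)"
    using p by (intro opt_value_bound(1)[OF n _ s R])
  have eq_iff: "opt_value p n = R / (1 + R) \<longleftrightarrow>
      (\<exists>k\<in>{s..n}. p k = R / (1 + R) \<and> (\<forall>j\<in>{s..n} - {k}. p j = 0))"
    using p by (intro opt_value_bound(2)[OF n _ s R])
  have "opt_value p n = R / (1 + R) \<longleftrightarrow>
      p s = R / (1 + R) \<and> (\<forall>j\<in>{s..n} - {s}. p j = 0)" if "R \<ge> 1 \<or> p s \<noteq> 0"
  proof -
    have "p s \<noteq> 0"
      using that success_at_threshold[OF n p s] R by blast
    \<comment> \<open>Any other \<open>k\<close> would put \<open>s\<close> among the indices of
      probability zero.\<close>
    then have "k = s" if "\<forall>j\<in>{s..n} - {k}. p j = 0" for k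
      using that s_mem by auto
    moreover have "s \<in> {s..n}"
      using s_mem by simp
    ultimately show ?thesis
      unfolding eq_iff by blast
  qed
  then show ?thesis
    using win le eq_iff single by blast
qed

end
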